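(* Let $\mathfrak g_2$ be the $2$-dimensional complex Lie algebra with basis $e_1,e_2$ and bracket determined by $[e_1,e_2]=e_1$, let $X=\mathbb{C}\oplus\mathfrak g_2$, and let $R:X^{\otimes 2}\otimes X^{\otimes 2}\to X^{\otimes 2}\otimes X^{\otimes 2}$ be the associated Yang-Baxter operator described in the context. Let $\tau: X^{\otimes 2}\otimes X^{\otimes 2}\to X^{\otimes 2}\otimes X^{\otimes 2}$, $\tau(u\otimes v)=v\otimes u$ for $u,v\in X^{\otimes 2}$, be the switching map. Then $R$ and $\tau$ are not gauge equivalent.
   Context: Elements of $X=\mathbb{C}\oplus\mathfrak g_2$ are pairs $(a,x)$. $\Delta(a,x)=(a,x)\otimes(1,0)+(1,0)\otimes(0,x)$, and Sweedler notation $(\mathbf 1\otimes\Delta)\Delta(x)=x^{(1)}\otimes x^{(2)}\otimes x^{(3)}$ is used. The linear map $T:X^{\otimes 3}\to X$ is $T((a,x)\otimes(b,y)\otimes(c,z))=(abc,\ bcx+c[x,y]+b[x,z]+[[x,y],z])$, and $$R(x\otimes y\otimes z\otimes w)= z^{(1)}\otimes w^{(1)}\otimes T(x\otimes z^{(2)}\otimes w^{(2)})\otimes T(y\otimes z^{(3)}\otimes w^{(3)}),\quad x,y,z,w\in X.$$ Two Yang-Baxter operators $R_1,R_2:V\otimes V\to V\otimes V$ are gauge equivalent if there is an invertible linear map $g:V\to V$ with $R_2=(g\otimes g)^{-1}\circ R_1\circ(g\otimes g)$. Here $V=X^{\otimes 2}$. *)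

theory Defs
  imports "HOL-Analysis.Analysis"
begin

section \<open>Complex vector spaces and their tensor products\<close>

text \<open>
  Finite-dimensional complex vector spaces are modelled by \<open>complex ^ 'n\<close>, with scalar
  multiplication \<open>(*s)\<close>.  Note that the library's unqualified \<open>linear\<close> means real linear.

  The tensor product of \<open>complex ^ 'a\<close> and \<open>complex ^ 'b\<close> is \<open>complex ^ ('a \<times> 'b)\<close>; its
  universal property is \<open>tensor_lift_tensor\<close>, \<open>clinear_tensor_lift\<close>, \<open>tensor_lift_unique\<close> below.
\<close>

abbreviation clinear :: "(complex ^ 'a \<Rightarrow> complex ^ 'b) \<Rightarrow> bool" where
  "clinear \<equiv> Vector_Spaces.linear (*s) (*s)"

definition cbilinear :: "(complex ^ 'a \<Rightarrow> complex ^ 'b \<Rightarrow> complex ^ 'c) \<Rightarrow> bool" where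
  "cbilinear f \<longleftrightarrow> (\<forall>x. clinear (f x)) \<and> (\<forall>y. clinear (\<lambda>x. f x y))"

definition tensor :: "complex ^ 'a \<Rightarrow> complex ^ 'b \<Rightarrow> complex ^ ('a \<times> 'b)"  (infixr "\<otimes>" 75) where
  "x \<otimes> y = (\<chi> p. x $ fst p * y $ snd p)"

text \<open>The linear map out of a tensor product induced by a bilinear map.\<close>

definition tensor_lift ::
  "(complex ^ 'a \<Rightarrow> complex ^ 'b \<Rightarrow> complex ^ 'c) \<Rightarrow> complex ^ ('a::finite \<times> 'b::finite) \<Rightarrow> complex ^ 'c"
  where "tensor_lift f t = (\<Sum>i\<in>UNIV. \<Sum>j\<in>UNIV. t $ (i, j) *s f (axis i 1) (axis j 1))"

definition tensor_lift3 ::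
  "(complex ^ 'a \<Rightarrow> complex ^ 'b \<Rightarrow> complex ^ 'c \<Rightarrow> complex ^ 'd) \<Rightarrow>
    complex ^ ('a::finite \<times> 'b::finite \<times> 'c::finite) \<Rightarrow> complex ^ 'd"
  where "tensor_lift3 f = tensor_lift (\<lambda>x. tensor_lift (f x))"

definition tensor_map ::
  "(complex ^ 'a \<Rightarrow> complex ^ 'c) \<Rightarrow> (complex ^ 'b \<Rightarrow> complex ^ 'd) \<Rightarrow>
    complex ^ ('a::finite \<times> 'b::finite) \<Rightarrow> complex ^ ('c \<times> 'd)"
  where "tensor_map f g = tensor_lift (\<lambda>x y. f x \<otimes> g y)"

definition switch :: "complex ^ ('a::finite \<times> 'b::finite) \<Rightarrow> complex ^ ('b \<times> 'a)" where
  "switch = tensor_lift (\<lambda>u v. v \<otimes> u)"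

text \<open>
  Stated for arbitrary self-maps of \<open>V \<otimes> V\<close>; it is of interest for Yang-Baxter operators.
  The inverse is a genuine two-sided one by \<open>bij_tensor_map\<close>.
\<close>

definition gauge_equivalent ::
  "(complex ^ ('a \<times> 'a) \<Rightarrow> complex ^ ('a \<times> 'a)) \<Rightarrow>
    (complex ^ ('a \<times> 'a) \<Rightarrow> complex ^ ('a::finite \<times> 'a)) \<Rightarrow> bool"
  where "gauge_equivalent R\<^sub>1 R\<^sub>2 \<longleftrightarrow>
    (\<exists>g. clinear g \<and> bij g \<and> R\<^sub>2 = inv (tensor_map g g) \<circ> R\<^sub>1 \<circ> tensor_map g g)"

lemma clinear_iff:
  "clinear f \<longleftrightarrow> (\<forall>x y. f (x + y) = f x + f y) \<and> (\<forall>c x. f (c *s x) = c *s f x)"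
  by (auto simp: Vector_Spaces.linear_def module_hom_def module_hom_axioms_def
      vec.module_axioms vec.vector_space_axioms)

lemma clinear_compose: "clinear f \<Longrightarrow> clinear g \<Longrightarrow> clinear (\<lambda>x. g (f x))"
  by (simp add: clinear_iff)

lemma clinear_expand:
  fixes f :: "complex ^ 'a::finite \<Rightarrow> complex ^ 'b"
  assumes "clinear f"
  shows "f x = (\<Sum>i\<in>UNIV. x $ i *s f (axis i 1))"
proof -
  interpret Vector_Spaces.linear "(*s)" "(*s)" f by fact
  have "f x = f (\<Sum>i\<in>UNIV. x $ i *s axis i 1)" by (simp add: basis_expansion)
  then show ?thesis by (simp add: sum scale)
qed

lemma tensor_axis: "axis i (1::complex) \<otimes> axis j 1 = axis (i, j) 1"
  by (auto simp: tensor_def axis_def vec_eq_iff)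

lemma cbilinear_tensor: "cbilinear (\<otimes>)"
  by (simp add: cbilinear_def clinear_iff tensor_def vec_eq_iff algebra_simps)

lemma clinear_tensor_lift: "clinear (tensor_lift f)"
  by (simp add: clinear_iff tensor_lift_def vec.scale_left_distrib sum.distrib vec.scale_sum_right)

lemma tensor_lift_tensor:
  assumes "cbilinear f"
  shows "tensor_lift f (x \<otimes> y) = f x y"
proof -
  have 1: "clinear (f z)" "clinear (\<lambda>x. f x z')" for z z'
    using assms by (auto simp: cbilinear_def)
  have "f x y = (\<Sum>i\<in>UNIV. x $ i *s f (axis i 1) y)"
    by (rule clinear_expand[OF 1(2)])
  also have "\<dots> = (\<Sum>i\<in>UNIV. x $ i *s (\<Sum>j\<in>UNIV. y $ j *s f (axis i 1) (axis j 1)))"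
    by (subst clinear_expand[OF 1(1), of _ y]) simp
  finally show ?thesis
    by (simp add: tensor_lift_def tensor_def vec.scale_sum_right)
qed

lemma clinear_tensor_ext:
  assumes "clinear h" "clinear h'" "\<And>x y. h (x \<otimes> y) = h' (x \<otimes> y)"
  shows "h = h'"
proof
  fix t
  have "h (axis p 1) = h' (axis p 1)" for p
    using assms(3)[of "axis (fst p) 1" "axis (snd p) 1"] by (simp add: tensor_axis)
  then show "h t = h' t"
    by (simp add: clinear_expand[OF assms(1), of t] clinear_expand[OF assms(2), of t])
qed

lemma tensor_lift_unique:
  assumes "cbilinear f" "clinear h" "\<And>x y. h (x \<otimes> y) = f x y"
  shows "h = tensor_lift f"
  by (rule clinear_tensor_ext) (simp_all add: assms clinear_tensor_lift tensor_lift_tensor)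

lemma tensor_map_tensor:
  assumes "clinear f" "clinear g"
  shows "tensor_map f g (x \<otimes> y) = f x \<otimes> g y"
  unfolding tensor_map_def
  by (rule tensor_lift_tensor)
    (use assms in \<open>simp add: cbilinear_def clinear_iff tensor_def vec_eq_iff algebra_simps\<close>)

lemma switch_tensor: "switch (u \<otimes> v) = v \<otimes> u"
  unfolding switch_def
  by (rule tensor_lift_tensor)
    (simp add: cbilinear_def clinear_iff tensor_def vec_eq_iff algebra_simps)

lemma bij_tensor_map:
  assumes f: "clinear f" "bij f" and g: "clinear g" "bij g"
  shows "bij (tensor_map f g)"
proof -
  have inv: "clinear (inv h)" if "clinear h" "bij h" for h :: "complex ^ 'n \<Rightarrow> complex ^ 'm"
    unfolding clinear_iff
  proof (intro conjI allI)
    have H: "h (inv h x) = x" "inv h (h y) = y" for x y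
      using that by (simp_all add: bij_is_inj bij_is_surj surj_f_inv_f)
    note L = that(1)[unfolded clinear_iff]
    show "inv h (x + y) = inv h x + inv h y" for x y
      using H(2)[of "inv h x + inv h y"] L by (simp add: H)
    show "inv h (c *s x) = c *s inv h x" for c x
      using H(2)[of "c *s inv h x"] L by (simp add: H)
  qed
  have F: "f (inv f x) = x" "inv f (f y) = y" for x y
    using f by (simp_all add: bij_is_inj bij_is_surj surj_f_inv_f)
  have G: "g (inv g x) = x" "inv g (g y) = y" for x y
    using g by (simp_all add: bij_is_inj bij_is_surj surj_f_inv_f)
  have lin: "clinear (tensor_map h k)" for h k
    by (simp add: tensor_map_def clinear_tensor_lift)
  have id: "clinear (\<lambda>t. t)"
    by (simp add: clinear_iff)
  have "(\<lambda>t. tensor_map (inv f) (inv g) (tensor_map f g t)) = (\<lambda>t. t)"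
    by (rule clinear_tensor_ext)
      (simp_all add: clinear_compose lin id tensor_map_tensor inv f g F G)
  moreover have "(\<lambda>t. tensor_map f g (tensor_map (inv f) (inv g) t)) = (\<lambda>t. t)"
    by (rule clinear_tensor_ext)
      (simp_all add: clinear_compose lin id tensor_map_tensor inv f g F G)
  ultimately show ?thesis
    by (intro o_bij[of "tensor_map (inv f) (inv g)"]) (simp_all add: o_def id_def)
qed


section \<open>The Lie algebra and the operator\<close>

type_synonym g2 = "complex ^ 2"

abbreviation e\<^sub>1 :: g2 where "e\<^sub>1 \<equiv> axis 1 1"
abbreviation e\<^sub>2 :: g2 where "e\<^sub>2 \<equiv> axis 2 1"

definition lie_bracket :: "g2 \<Rightarrow> g2 \<Rightarrow> g2" where
  "lie_bracket x y = (x $ 1 * y $ 2 - x $ 2 * y $ 1) *s e\<^sub>1"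

lemma lie_bracket_basis: "lie_bracket e\<^sub>1 e\<^sub>2 = e\<^sub>1"
  by (simp add: lie_bracket_def axis_def)

lemma cbilinear_lie_bracket: "cbilinear lie_bracket"
  by (simp add: cbilinear_def clinear_iff lie_bracket_def vec_eq_iff algebra_simps)

lemma lie_bracket_alternating: "lie_bracket x x = 0"
  by (simp add: lie_bracket_def)

lemma lie_bracket_jacobi:
  "lie_bracket x (lie_bracket y z) + lie_bracket y (lie_bracket z x) + lie_bracket z (lie_bracket x y) = 0"
  by (simp add: lie_bracket_def vec_eq_iff axis_def algebra_simps)

text \<open>
  The space \<open>X\<close> is the direct sum of \<open>complex\<close> and \<open>g2\<close>, its basis being indexed by the sum
  of a one-element and a two-element type; \<open>pr a x\<close> is the element written \<open>(a, x)\<close>.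
\<close>

type_synonym X_ind = "1 + 2"
type_synonym X = "complex ^ X_ind"

definition pr :: "complex \<Rightarrow> g2 \<Rightarrow> X" where
  "pr a x = (\<chi> i. case i of Inl _ \<Rightarrow> a | Inr j \<Rightarrow> x $ j)"

definition scalar_part :: "X \<Rightarrow> complex" where
  "scalar_part u = u $ Inl 1"

definition lie_part :: "X \<Rightarrow> g2" where
  "lie_part u = (\<chi> j. u $ Inr j)"

lemma scalar_part_pr [simp]: "scalar_part (pr a x) = a"
  by (simp add: scalar_part_def pr_def)

lemma lie_part_pr [simp]: "lie_part (pr a x) = x"
  by (simp add: lie_part_def pr_def)

lemma pr_parts [simp]: "pr (scalar_part u) (lie_part u) = u"
  by (auto simp: pr_def scalar_part_def lie_part_def vec_eq_iff split: sum.split)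

definition comult :: "X \<Rightarrow> complex ^ (X_ind \<times> X_ind)"  ("\<Delta>") where
  "\<Delta> u = u \<otimes> pr 1 0 + pr 1 0 \<otimes> pr 0 (lie_part u)"

definition comult3 :: "X \<Rightarrow> complex ^ (X_ind \<times> X_ind \<times> X_ind)"  ("\<Delta>\<^sub>3") where
  "\<Delta>\<^sub>3 u = tensor_map id \<Delta> (\<Delta> u)"

definition T_trilinear :: "X \<Rightarrow> X \<Rightarrow> X \<Rightarrow> X" where
  "T_trilinear u v w =
    (let a = scalar_part u; x = lie_part u; b = scalar_part v; y = lie_part v;
         c = scalar_part w; z = lie_part w
     in pr (a * b * c)
          ((b * c) *s x + c *s lie_bracket x y + b *s lie_bracket x z
            + lie_bracket (lie_bracket x y) z))"

definition T_map :: "complex ^ (X_ind \<times> X_ind \<times> X_ind) \<Rightarrow> X" where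
  "T_map = tensor_lift3 T_trilinear"

text \<open>
  In Sweedler notation the value on \<open>(x \<otimes> y) \<otimes> (z \<otimes> w)\<close> is a sum over the terms
  \<open>z1 \<otimes> z2 \<otimes> z3\<close> of \<open>\<Delta>\<^sub>3 z\<close> and \<open>w1 \<otimes> w2 \<otimes> w3\<close> of \<open>\<Delta>\<^sub>3 w\<close>, that is, the linear extension
  in each of these two triple tensors.
\<close>

type_synonym V_ind = "X_ind \<times> X_ind"

definition YB_quad :: "X \<Rightarrow> X \<Rightarrow> X \<Rightarrow> X \<Rightarrow> complex ^ (V_ind \<times> V_ind)" where
  "YB_quad x y z w =
    tensor_lift3 (\<lambda>z1 z2 z3.
      tensor_lift3 (\<lambda>w1 w2 w3.
        (z1 \<otimes> w1) \<otimes> (T_map (x \<otimes> z2 \<otimes> w2) \<otimes> T_map (y \<otimes> z3 \<otimes> w3)))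
      (\<Delta>\<^sub>3 w)) (\<Delta>\<^sub>3 z)"

definition YB_op ::
  "complex ^ (V_ind \<times> V_ind) \<Rightarrow> complex ^ (V_ind \<times> V_ind)"
  where "YB_op = tensor_lift (\<lambda>s t. tensor_lift (\<lambda>x y. tensor_lift (YB_quad x y) t) s)"

lemma comult_pr: "\<Delta> (pr a x) = pr a x \<otimes> pr 1 0 + pr 1 0 \<otimes> pr 0 x"
  by (simp add: comult_def)

lemma T_trilinear_pr:
  "T_trilinear (pr a x) (pr b y) (pr c z) =
    pr (a * b * c)
      ((b * c) *s x + c *s lie_bracket x y + b *s lie_bracket x z + lie_bracket (lie_bracket x y) z)"
  by (simp add: T_trilinear_def Let_def)

lemma tensor_simps:
  "(x + x') \<otimes> y = x \<otimes> y + x' \<otimes> y" "x \<otimes> (y + y') = x \<otimes> y + x \<otimes> y'"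
  "(c *s x) \<otimes> y = c *s (x \<otimes> y)" "x \<otimes> (c *s y) = c *s (x \<otimes> y)"
  by (simp_all add: tensor_def vec_eq_iff algebra_simps)

lemma tensor_lift_add: "tensor_lift f (s + t) = tensor_lift f s + tensor_lift f t"
  and tensor_lift_scale: "tensor_lift f (c *s t) = c *s tensor_lift f t"
  using clinear_tensor_lift[of f] by (auto simp: clinear_iff)

lemma tensor_lift_fun_add:
  "tensor_lift (\<lambda>x y. f x y + g x y) = (\<lambda>t. tensor_lift f t + tensor_lift g t)"
  and tensor_lift_fun_scale: "tensor_lift (\<lambda>x y. c *s f x y) = (\<lambda>t. c *s tensor_lift f t)"
  by (simp_all add: fun_eq_iff tensor_lift_def vec.scale_right_distrib sum.distrib vec.scale_sum_right
      vector_smult_assoc mult.commute)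

lemma parts_linear:
  "scalar_part (u + v) = scalar_part u + scalar_part v"
  "scalar_part (c *s u) = c * scalar_part u"
  "lie_part (u + v) = lie_part u + lie_part v"
  "lie_part (c *s u) = c *s lie_part u"
  by (simp_all add: scalar_part_def lie_part_def vec_eq_iff)

lemma T_trilinear_eqs:
  "T_trilinear (u + u') v w = T_trilinear u v w + T_trilinear u' v w"
  "T_trilinear u (v + v') w = T_trilinear u v w + T_trilinear u v' w"
  "T_trilinear u v (w + w') = T_trilinear u v w + T_trilinear u v w'"
  "T_trilinear (c *s u) v w = c *s T_trilinear u v w"
  "T_trilinear u (c *s v) w = c *s T_trilinear u v w"
  "T_trilinear u v (c *s w) = c *s T_trilinear u v w"
  by (auto simp: T_trilinear_def Let_def parts_linear pr_def lie_bracket_def vec_eq_iff axis_def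
      algebra_simps split: sum.split)

lemma T_map_tensor: "T_map (u \<otimes> v \<otimes> w) = T_trilinear u v w"
proof -
  have 1: "tensor_lift (T_trilinear u) (v \<otimes> w) = T_trilinear u v w" for u v w
    by (rule tensor_lift_tensor) (simp add: cbilinear_def clinear_iff T_trilinear_eqs)
  have "tensor_lift (\<lambda>x. tensor_lift (T_trilinear x)) (u \<otimes> v \<otimes> w) = tensor_lift (T_trilinear u) (v \<otimes> w)"
  proof (rule tensor_lift_tensor)
    have "T_trilinear (x + x') = (\<lambda>y z. T_trilinear x y z + T_trilinear x' y z)"
      "T_trilinear (c *s x) = (\<lambda>y z. c *s T_trilinear x y z)" for x x' c
      by (simp_all add: fun_eq_iff T_trilinear_eqs)
    then show "cbilinear (\<lambda>x. tensor_lift (T_trilinear x))"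
      by (simp add: cbilinear_def clinear_iff tensor_lift_add tensor_lift_scale
          tensor_lift_fun_add tensor_lift_fun_scale)
  qed
  then show ?thesis
    by (simp add: T_map_def tensor_lift3_def 1)
qed

lemma T_map_linear: "T_map (s + t) = T_map s + T_map t" "T_map (c *s t) = c *s T_map t"
  by (simp_all add: T_map_def tensor_lift3_def tensor_lift_add tensor_lift_scale)

lemma clinear_comult: "clinear \<Delta>"
  by (auto simp: clinear_iff comult_def tensor_def pr_def lie_part_def vec_eq_iff algebra_simps
      split: sum.split)

lemma comult3_linear: "\<Delta>\<^sub>3 (u + v) = \<Delta>\<^sub>3 u + \<Delta>\<^sub>3 v" "\<Delta>\<^sub>3 (c *s u) = c *s \<Delta>\<^sub>3 u"
  using clinear_comult
  by (simp_all add: comult3_def tensor_map_def tensor_lift_add tensor_lift_scale clinear_iff)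

lemma YB_quad_eqs:
  "YB_quad (x + x') y z w = YB_quad x y z w + YB_quad x' y z w"
  "YB_quad x (y + y') z w = YB_quad x y z w + YB_quad x y' z w"
  "YB_quad x y (z + z') w = YB_quad x y z w + YB_quad x y z' w"
  "YB_quad x y z (w + w') = YB_quad x y z w + YB_quad x y z w'"
  "YB_quad (c *s x) y z w = c *s YB_quad x y z w"
  "YB_quad x (c *s y) z w = c *s YB_quad x y z w"
  "YB_quad x y (c *s z) w = c *s YB_quad x y z w"
  "YB_quad x y z (c *s w) = c *s YB_quad x y z w"
  by (simp_all add: YB_quad_def tensor_lift3_def comult3_linear T_map_linear tensor_simps
      tensor_lift_add tensor_lift_scale tensor_lift_fun_add tensor_lift_fun_scale)

lemma clinear_YB_op: "clinear YB_op"
  by (simp add: YB_op_def clinear_tensor_lift)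

lemma YB_op_tensor: "YB_op ((x \<otimes> y) \<otimes> (z \<otimes> w)) = YB_quad x y z w"
proof -
  have ext: "YB_quad (x + x') y = (\<lambda>z w. YB_quad x y z w + YB_quad x' y z w)"
    "YB_quad x (y + y') = (\<lambda>z w. YB_quad x y z w + YB_quad x y' z w)"
    "YB_quad (c *s x) y = (\<lambda>z w. c *s YB_quad x y z w)"
    "YB_quad x (c *s y) = (\<lambda>z w. c *s YB_quad x y z w)" for x x' y y' c
    by (simp_all add: fun_eq_iff YB_quad_eqs)
  have 1: "tensor_lift (YB_quad x y) (z \<otimes> w) = YB_quad x y z w"
    by (rule tensor_lift_tensor) (simp add: cbilinear_def clinear_iff YB_quad_eqs)
  have 2: "tensor_lift (\<lambda>x y. tensor_lift (YB_quad x y) t) (x \<otimes> y) = tensor_lift (YB_quad x y) t" for t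
    by (rule tensor_lift_tensor)
      (simp add: cbilinear_def clinear_iff ext tensor_lift_fun_add tensor_lift_fun_scale)
  have "YB_op ((x \<otimes> y) \<otimes> (z \<otimes> w))
      = tensor_lift (\<lambda>x y. tensor_lift (YB_quad x y) (z \<otimes> w)) (x \<otimes> y)"
    unfolding YB_op_def
    by (rule tensor_lift_tensor)
      (simp add: cbilinear_def clinear_iff tensor_lift_add tensor_lift_scale
        tensor_lift_fun_add tensor_lift_fun_scale)
  then show ?thesis
    by (simp add: 1 2)
qed

end

theory Submission
  imports Defs
begin

text \<open>
  The switch commutes with every \<open>g \<otimes> g\<close>, so the only operator gauge equivalent to it is the
  switch itself. The operator \<open>R\<close> differs from the switch because the bracket is nonzero:
  with \<open>x = (0, e\<^sub>1)\<close>, \<open>z = (0, e\<^sub>2)\<close> and \<open>1 = (1, 0)\<close> one finds that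
  \<open>R ((x \<otimes> 1) \<otimes> (z \<otimes> 1)) = (z \<otimes> 1) \<otimes> (x \<otimes> 1) + (1 \<otimes> 1) \<otimes> ((0, [e\<^sub>1, e\<^sub>2]) \<otimes> 1)\<close>.
\<close>

lemma gauge_equivalent_switchD:
  fixes R :: "complex ^ ('a::finite \<times> 'a) \<Rightarrow> complex ^ ('a \<times> 'a)"
  assumes "gauge_equivalent R switch"
  shows "R = switch"
proof -
  from assms obtain g :: "complex ^ 'a \<Rightarrow> complex ^ 'a" where g: "clinear g" "bij g"
    and eq: "switch = inv (tensor_map g g) \<circ> R \<circ> tensor_map g g"
    unfolding gauge_equivalent_def by blast
  let ?G = "tensor_map g g"
  have bij: "bij ?G" using g by (intro bij_tensor_map)
  have lin: "clinear ?G" "clinear (switch :: complex ^ ('a \<times> 'a) \<Rightarrow> _)"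
    by (simp_all add: tensor_map_def switch_def clinear_tensor_lift)
  have commute: "(\<lambda>t. switch (?G t)) = (\<lambda>t. ?G (switch t))"
  proof (rule clinear_tensor_ext)
    show "clinear (\<lambda>t. switch (?G t))" "clinear (\<lambda>t. ?G (switch t))"
      by (rule clinear_compose[OF lin] clinear_compose[OF lin(2,1)])+
  qed (simp add: g(1) tensor_map_tensor switch_tensor)
  \<comment> \<open>Surjectivity of \<open>?G\<close> cancels \<open>inv ?G\<close> on the left.
    Together with \<open>commute\<close> this makes \<open>R\<close> and \<open>switch\<close> agree
    on the range of \<open>?G\<close>, which is everything.\<close>
  have conj: "?G (switch t) = R (?G t)" for t
    unfolding eq comp_def by (rule surj_f_inv_f[OF bij_is_surj[OF bij]])
  show "R = switch"
  proof
    fix s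
    obtain t where "s = ?G t" by (rule surjE[OF bij_is_surj[OF bij]])
    then show "R s = switch s" using fun_cong[OF commute, of t] conj[of t] by metis
  qed
qed

text \<open>The defining sum collapses to one summand for arbitrary \<open>f\<close>, so the nested
  lifts in \<open>YB_quad\<close> can be evaluated on basis vectors by rewriting alone.\<close>

lemma tensor_lift_axis: "tensor_lift f (axis (i, j) 1) = f (axis i 1) (axis j 1)"
proof -
  have "tensor_lift f (axis (i, j) 1)
      = (\<Sum>i'\<in>UNIV. \<Sum>j'\<in>UNIV. if j' = j then if i' = i then f (axis i 1) (axis j 1) else 0 else 0)"
    unfolding tensor_lift_def by (intro sum.cong refl) (auto simp: axis_def)
  then show ?thesis by simp
qed

lemma tensor_map_add: "tensor_map f g (s + t) = tensor_map f g s + tensor_map f g t"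
  by (simp add: tensor_map_def tensor_lift_add)

lemma tensor_lift3_add: "tensor_lift3 f (s + t) = tensor_lift3 f s + tensor_lift3 f t"
  by (simp add: tensor_lift3_def tensor_lift_add)

lemma tensor_lift3_axis:
  "tensor_lift3 f (axis i 1 \<otimes> axis j 1 \<otimes> axis k 1) = f (axis i 1) (axis j 1) (axis k 1)"
  by (simp add: tensor_lift3_def tensor_axis tensor_lift_axis)

lemma pr_axis: "pr 1 0 = axis (Inl 1) 1" "pr 0 (axis j 1) = axis (Inr j) 1"
  by (auto simp: pr_def axis_def vec_eq_iff split: sum.split)

lemma tensor_zero [simp]: "0 \<otimes> y = 0" "x \<otimes> 0 = 0"
  by (simp_all add: tensor_def vec_eq_iff)

lemma pr_zero [simp]: "pr 0 0 = 0"
  by (auto simp: pr_def vec_eq_iff split: sum.split)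

lemma clinear_id: "clinear id"
  by (simp add: clinear_iff)

lemma comult3_pr_one: "\<Delta>\<^sub>3 (pr 1 0) = pr 1 0 \<otimes> pr 1 0 \<otimes> pr 1 0"
  by (simp add: comult3_def comult_pr tensor_map_tensor clinear_comult clinear_id)

text \<open>\<open>(0, x)\<close> is primitive over the group-like \<open>(1, 0)\<close>, so
  \<open>x\<close> visits each of the three legs once.\<close>

lemma comult3_pr_primitive:
  "\<Delta>\<^sub>3 (pr 0 x) = pr 0 x \<otimes> pr 1 0 \<otimes> pr 1 0 + pr 1 0 \<otimes> pr 0 x \<otimes> pr 1 0
    + pr 1 0 \<otimes> pr 1 0 \<otimes> pr 0 x"
  unfolding comult3_def comult_pr tensor_map_add tensor_map_tensor[OF clinear_id clinear_comult]
  by (simp add: comult_pr tensor_simps add.assoc)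

lemma YB_quad_e1_e2:
  "YB_quad (pr 0 e\<^sub>1) (pr 1 0) (pr 0 e\<^sub>2) (pr 1 0)
    = (pr 0 e\<^sub>2 \<otimes> pr 1 0) \<otimes> (pr 0 e\<^sub>1 \<otimes> pr 1 0) + (pr 1 0 \<otimes> pr 1 0) \<otimes> (pr 0 e\<^sub>1 \<otimes> pr 1 0)"
proof -
  have lift: "tensor_lift3 f (pr 1 0 \<otimes> pr 1 0 \<otimes> pr 1 0) = f (pr 1 0) (pr 1 0) (pr 1 0)"
    "tensor_lift3 f (pr 0 e\<^sub>2 \<otimes> pr 1 0 \<otimes> pr 1 0) = f (pr 0 e\<^sub>2) (pr 1 0) (pr 1 0)"
    "tensor_lift3 f (pr 1 0 \<otimes> pr 0 e\<^sub>2 \<otimes> pr 1 0) = f (pr 1 0) (pr 0 e\<^sub>2) (pr 1 0)"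
    "tensor_lift3 f (pr 1 0 \<otimes> pr 1 0 \<otimes> pr 0 e\<^sub>2) = f (pr 1 0) (pr 1 0) (pr 0 e\<^sub>2)"
    for f :: "X \<Rightarrow> X \<Rightarrow> X \<Rightarrow> complex ^ (V_ind \<times> V_ind)"
    by (simp_all only: pr_axis tensor_lift3_axis)
  have bracket: "lie_bracket x 0 = 0" "lie_bracket 0 x = 0" for x
    by (simp_all add: lie_bracket_def)
  \<comment> \<open>With \<open>e\<^sub>2\<close> in the first leg the term is the switched tensor;
    in the second leg, \<open>T\<close> produces the bracket of \<open>e\<^sub>1\<close> and
    \<open>e\<^sub>2\<close>; in the third leg, the factor
    \<open>T((1,0), (0,e\<^sub>2), (1,0))\<close> vanishes.\<close>
  show ?thesis
    by (simp add: YB_quad_def comult3_pr_one comult3_pr_primitive tensor_lift3_add lift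
        T_map_tensor T_trilinear_pr bracket lie_bracket_basis)
qed

lemma YB_op_neq_switch: "YB_op \<noteq> switch"
proof
  assume "YB_op = switch"
  then have "YB_quad (pr 0 e\<^sub>1) (pr 1 0) (pr 0 e\<^sub>2) (pr 1 0)
      = (pr 0 e\<^sub>2 \<otimes> pr 1 0) \<otimes> (pr 0 e\<^sub>1 \<otimes> pr 1 0)"
    by (metis YB_op_tensor switch_tensor)
  then have "(pr 1 0 \<otimes> pr 1 0) \<otimes> (pr 0 e\<^sub>1 \<otimes> pr 1 0) = 0"
    by (simp add: YB_quad_e1_e2)
  \<comment> \<open>The surplus term is a single basis vector of the tensor product.\<close>
  then show False
    by (simp add: pr_axis tensor_axis axis_eq_0_iff)
qed

theorem proposition6p3:
  "\<not> gauge_equivalent YB_op (switch :: complex ^ (V_ind \<times> V_ind) \<Rightarrow> complex ^ (V_ind \<times> V_ind))"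
  using gauge_equivalent_switchD YB_op_neq_switch by blast

end
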